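(* Let $a,b$ be integers with $1<a<b$, $\nu_{2}(a)\neq \nu_{2}(b)$ and $\gcd(a,b)>1$. Then the equation $(a^{n}-1)(b^{n}-1)=x^{2}$ has no solutions in positive integers $n,x$ with $2\mid n$.
   Context: For a nonzero integer $m$, $\nu_{2}(m)$ denotes the exponent of $2$ in the prime factorization of $m$ (so $\nu_2(m)=0$ if $m$ is odd). *)

theory Defs
  imports "HOL-Number_Theory.Number_Theory"
begin

end

theory Submission
  imports Defs
begin

text \<open>
  With \<open>n = 2 m\<close>, \<open>X = a ^ m\<close> and \<open>Z = b ^ m\<close> the equation says that
  \<open>(X\<^sup>2 - 1) (Z\<^sup>2 - 1)\<close> is a square, i.e. that \<open>X\<close> and \<open>Z\<close> are first coordinates of solutions
  of one Pell equation \<open>X\<^sup>2 - D Y\<^sup>2 = 1\<close>. Write \<open>X = X\<^sub>r\<close> and \<open>Z = X\<^sub>s\<close>, where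
  \<open>X\<^sub>k\<close> belongs to the \<open>k\<close>-th power of the fundamental solution. The relation
  \<open>X\<^sub>r + X\<^sub>r\<^sub>-\<^sub>2\<^sub>s = 2 X\<^sub>s X\<^sub>r\<^sub>-\<^sub>s\<close> allows one to run a Euclidean algorithm that replaces the
  larger index \<open>r\<close> by \<open>\<bar>r - 2 s\<bar>\<close>. Since \<open>X\<^sub>r \<equiv> - X\<^sub>r\<^sub>-\<^sub>2\<^sub>s\<close> modulo \<open>2 X\<^sub>s\<close>, a step changes neither
  the common divisors of the pair nor whether both members contain the same power of
  \<open>2\<close>. The algorithm ends either at a pair of
  equal numbers, or at a pair containing \<open>X\<^sub>0 = 1\<close>. Hence two such numbers have the same
  \<open>2\<close>-adic valuation or are coprime (lemma \<open>pell_coprime_or_same_multiplicity\<close>), and both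
  alternatives pass from \<open>a ^ m\<close>, \<open>b ^ m\<close> to \<open>a\<close>, \<open>b\<close>.

  The descent can be written without \<open>D\<close> and the fundamental solution: if \<open>w\<close> is the
  nonnegative root of \<open>(X\<^sup>2 - 1) (Z\<^sup>2 - 1)\<close>, that is \<open>D Y\<^sub>r Y\<^sub>s\<close>, then \<open>X\<^sub>r\<^sub>-\<^sub>s = X Z - w\<close>.
\<close>

text \<open>
  One step of the descent. In the notation of powers of the fundamental solution, the new
  number \<open>2 Z (X Z - w) - X\<close> is \<open>X\<^sub>r\<^sub>-\<^sub>2\<^sub>s\<close>, and the root that witnesses the
  last claim is \<open>D Y\<^sub>r\<^sub>-\<^sub>2\<^sub>s Y\<^sub>s\<close> up to sign.
\<close>

lemma pell_descent_step:
  fixes X Z w :: int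
  assumes "1 < Z" and "Z < X" and "0 \<le> w" and w: "(X\<^sup>2 - 1) * (Z\<^sup>2 - 1) = w\<^sup>2"
  defines "X' \<equiv> 2 * Z * (X * Z - w) - X"
  shows "0 < X'" and "X' < X" and "\<exists>w'. (X'\<^sup>2 - 1) * (Z\<^sup>2 - 1) = w'\<^sup>2"
proof -
  have sq: "1 < Z\<^sup>2" "Z\<^sup>2 < X\<^sup>2"
    using assms(1,2) power_strict_mono[of 1 Z 2] power_strict_mono[of Z X 2] by auto
  \<comment> \<open>Both bounds compare squares, because \<open>w\<close> is known only through \<open>w\<^sup>2\<close>.\<close>
  have "(X * (2 * Z\<^sup>2 - 1))\<^sup>2 - (2 * Z * w)\<^sup>2 = (2 * Z\<^sup>2 - 1)\<^sup>2 + X\<^sup>2 - 1"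
    by (simp add: power_mult_distrib w[symmetric]) (simp add: algebra_simps power2_eq_square)
  then have "(2 * Z * w)\<^sup>2 < (X * (2 * Z\<^sup>2 - 1))\<^sup>2"
    using sq zero_le_power2[of "2 * Z\<^sup>2 - 1"] by linarith
  then have "2 * Z * w < X * (2 * Z\<^sup>2 - 1)"
    by (rule power_less_imp_less_base) (use assms sq in auto)
  then show "0 < X'"
    by (simp add: X'_def algebra_simps power2_eq_square)
  have "(Z * w)\<^sup>2 - (X * (Z\<^sup>2 - 1))\<^sup>2 = (Z\<^sup>2 - 1) * (X\<^sup>2 - Z\<^sup>2)"
    by (simp add: power_mult_distrib w[symmetric]) (simp add: algebra_simps power2_eq_square)
  moreover have "0 < (Z\<^sup>2 - 1) * (X\<^sup>2 - Z\<^sup>2)"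
    using sq by (intro mult_pos_pos) auto
  ultimately have "(X * (Z\<^sup>2 - 1))\<^sup>2 < (Z * w)\<^sup>2"
    by linarith
  then have "X * (Z\<^sup>2 - 1) < Z * w"
    by (rule power_less_imp_less_base) (use assms in auto)
  then show "X' < X"
    by (simp add: X'_def algebra_simps power2_eq_square)
  have "(X'\<^sup>2 - 1) * (Z\<^sup>2 - 1) - (2 * X * Z * (Z\<^sup>2 - 1) - w * (2 * Z\<^sup>2 - 1))\<^sup>2
      = (X\<^sup>2 - 1) * (Z\<^sup>2 - 1) - w\<^sup>2"
    by (simp add: X'_def algebra_simps power2_eq_square)
  then have "(X'\<^sup>2 - 1) * (Z\<^sup>2 - 1) = (2 * X * Z * (Z\<^sup>2 - 1) - w * (2 * Z\<^sup>2 - 1))\<^sup>2"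
    using w by simp
  then show "\<exists>w'. (X'\<^sup>2 - 1) * (Z\<^sup>2 - 1) = w'\<^sup>2" ..
qed

text \<open>
  If \<open>2 ^ j\<close> is the exact power of \<open>2\<close> in \<open>z\<close> and in \<open>y\<close>, then \<open>x \<equiv> - y\<close> modulo \<open>2 ^ (j + 1)\<close>,
  so it is the exact power in \<open>x\<close> too.
\<close>

lemma multiplicity_two_cong:
  fixes x y z t :: int
  assumes "x + y = 2 * z * t" and "z \<noteq> 0" and "y \<noteq> 0"
    and eq: "multiplicity 2 y = multiplicity 2 z"
  shows "multiplicity 2 x = multiplicity 2 z"
proof (rule multiplicity_eqI)
  define j where "j = multiplicity 2 z"
  have z: "2 ^ j dvd z"
    unfolding j_def by (rule multiplicity_dvd)
  have y: "2 ^ j dvd y"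
    unfolding j_def eq[symmetric] by (rule multiplicity_dvd)
  have ny: "\<not> 2 ^ Suc j dvd y"
    using \<open>y \<noteq> 0\<close> by (simp add: power_dvd_iff_le_multiplicity j_def eq del: power_Suc)
  have s: "2 ^ Suc j dvd x + y"
    using z by (simp add: assms(1) mult_dvd_mono)
  then show "\<not> 2 ^ Suc (multiplicity 2 z) dvd x"
    using ny unfolding j_def by (metis dvd_add_right_iff)
  have "2 ^ j dvd x + y"
    using s by (rule dvd_trans[rotated]) simp
  then show "2 ^ multiplicity 2 z dvd x"
    using y by (simp add: j_def dvd_add_left_iff)
qed

lemma pell_coprime_or_same_multiplicity:
  fixes X Z w :: int
  assumes "0 < X" and "0 < Z" and "(X\<^sup>2 - 1) * (Z\<^sup>2 - 1) = w\<^sup>2"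
  shows "coprime X Z \<or> multiplicity 2 X = multiplicity 2 Z"
  using assms
proof (induction "nat (X + Z)" arbitrary: X Z w rule: less_induct)
  case less
  have descent: "coprime x z \<or> multiplicity 2 x = multiplicity 2 z"
    if sum: "x + z = X + Z" and "0 < z" "z < x" and v: "(x\<^sup>2 - 1) * (z\<^sup>2 - 1) = w\<^sup>2"
    for x z :: int
  proof (cases "z = 1")
    case False
    then have "1 < z" using \<open>0 < z\<close> by simp
    define y where "y = 2 * z * (x * z - \<bar>w\<bar>) - x"
    have xy: "x + y = 2 * z * (x * z - \<bar>w\<bar>)"
      by (simp add: y_def)
    note step = pell_descent_step[OF \<open>1 < z\<close> \<open>z < x\<close> abs_ge_zero, of w, folded y_def]
    have y: "0 < y" "y < x" and "\<exists>w'. (y\<^sup>2 - 1) * (z\<^sup>2 - 1) = w'\<^sup>2"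
      using step v by simp_all
    then obtain w' where "(y\<^sup>2 - 1) * (z\<^sup>2 - 1) = w'\<^sup>2" by blast
    then have "coprime y z \<or> multiplicity 2 y = multiplicity 2 z"
      using less.hyps[of y z w'] y \<open>0 < z\<close> sum by simp
    then show ?thesis
    proof
      assume "coprime y z"
      have "coprime x z"
      proof (rule coprimeI)
        fix d assume d: "d dvd x" "d dvd z"
        then have "d dvd x + y"
          by (simp add: xy)
        then have "d dvd y"
          using d(1) by (simp add: dvd_add_right_iff)
        then show "is_unit d"
          using \<open>coprime y z\<close> d(2) by (metis coprime_common_divisor)
      qed
      then show ?thesis ..
    next
      assume "multiplicity 2 y = multiplicity 2 z"
      then show ?thesis
        using multiplicity_two_cong[OF xy] y \<open>0 < z\<close> by simp
    qed
  qed simp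
  consider "X = Z" | "Z < X" | "X < Z" by linarith
  then show ?case
  proof cases
    case 2
    then show ?thesis using descent[of X Z] less.prems by simp
  next
    case 3
    then show ?thesis
      using descent[of Z X] less.prems by (auto simp: mult.commute coprime_commute add.commute)
  qed simp
qed

theorem theorem12:
  fixes a b :: int
  assumes "1 < a" and "a < b"
    and "multiplicity 2 a \<noteq> multiplicity 2 b"
    and "gcd a b > 1"
  shows "\<not> (\<exists>(n::nat) (x::int). n > 0 \<and> x > 0 \<and> 2 dvd n \<and> (a ^ n - 1) * (b ^ n - 1) = x\<^sup>2)"
proof
  assume "\<exists>(n::nat) (x::int). n > 0 \<and> x > 0 \<and> 2 dvd n \<and> (a ^ n - 1) * (b ^ n - 1) = x\<^sup>2"
  then obtain n :: nat and x :: int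
    where "n > 0" "2 dvd n" and x: "(a ^ n - 1) * (b ^ n - 1) = x\<^sup>2"
    by blast
  then obtain m where n: "n = m * 2" and "m > 0"
    by (metis dvd_div_mult_self gr0I mult_zero_left)
  have "((a ^ m)\<^sup>2 - 1) * ((b ^ m)\<^sup>2 - 1) = x\<^sup>2"
    using x by (simp add: n power_mult)
  then have "coprime (a ^ m) (b ^ m) \<or> multiplicity 2 (a ^ m) = multiplicity 2 (b ^ m)"
    using assms by (intro pell_coprime_or_same_multiplicity) auto
  moreover have "\<not> coprime a b"
    using assms by (auto simp: coprime_iff_gcd_eq_1)
  moreover have "multiplicity 2 (c ^ m) = m * multiplicity 2 c" if "1 < c" for c :: int
    using that by (simp add: prime_elem_multiplicity_power_distrib)
  ultimately show False
    using assms \<open>m > 0\<close> by simp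
qed

end
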